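(* There exists a graph $G$ with seven vertices such that it is not possible in a quadratic computation tree to compute the coordinates of every possible Fruchterman and Reingold equilibrium of $G$, and it is not possible in a quadratic computation tree to compute the coordinates of every possible Kamada and Kawai equilibrium of $G$.
   Context: Points of the plane are identified with complex numbers $x+iy$. An algebraic computation tree is a rooted tree whose computation nodes compute a value as the sum, difference, product or quotient of integer constants and values computed at ancestor nodes, and whose decision nodes test whether a previously computed value is greater than zero and branch accordingly. A quadratic computation tree additionally allows, at computation nodes, square roots and complex conjugation of previously computed values. A tree computes a drawing if it computes all vertex coordinates. Fruchterman--Reingold model (scale constant $k=1$): in a drawing of a graph with distinct vertex positions, each vertex is pulled toward each of its neighbours by a force of magnitude $d^2$ and pushed away from every other vertex by a force of magnitude $1/d$, where $d$ is the distance between them; a Fruchterman and Reingold equilibrium is a drawing in which the total force at every vertex is zero. Kamada--Kawai model (constants $L=K=1$): for a connected graph with vertex positions $p_i$, the energy is $E=\sum_i\sum_{j>i}\frac12 k_{ij}(|p_i-p_j|-\ell_{ij})^2$ where $d_{ij}$ is the graph-theoretic distance, $\ell_{ij}=d_{ij}$ and $k_{ij}=1/d_{ij}^2$; a Kamada and Kawai equilibrium is a drawing at which $E$ is at a local minimum. *)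

theory Defs
  imports Complex_Main
begin

text \<open>An operand of an arithmetic computation node: an integer constant, or the value
computed at an ancestor node (referred to by its position in the list of values computed
so far along the current root-to-node path).\<close>
datatype operand = Cst int | Val nat

datatype qtree =
    Leaf
  | Add operand operand qtree
  | Sub operand operand qtree
  | Mul operand operand qtree
  | Dv operand operand qtree
  | Sqrt nat qtree
  | Conj nat qtree
  | Test nat qtree qtree

fun op_ok :: "nat \<Rightarrow> operand \<Rightarrow> bool" where
  "op_ok n (Cst c) = True"
| "op_ok n (Val i) = (i < n)"

fun wf_qtree :: "nat \<Rightarrow> qtree \<Rightarrow> bool" where
  "wf_qtree n Leaf = True"
| "wf_qtree n (Add a b t) = (op_ok n a \<and> op_ok n b \<and> wf_qtree (Suc n) t)"
| "wf_qtree n (Sub a b t) = (op_ok n a \<and> op_ok n b \<and> wf_qtree (Suc n) t)"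
| "wf_qtree n (Mul a b t) = (op_ok n a \<and> op_ok n b \<and> wf_qtree (Suc n) t)"
| "wf_qtree n (Dv a b t) = (op_ok n a \<and> op_ok n b \<and> wf_qtree (Suc n) t)"
| "wf_qtree n (Sqrt i t) = (i < n \<and> wf_qtree (Suc n) t)"
| "wf_qtree n (Conj i t) = (i < n \<and> wf_qtree (Suc n) t)"
| "wf_qtree n (Test i t1 t2) = (i < n \<and> wf_qtree n t1 \<and> wf_qtree n t2)"

fun opval :: "complex list \<Rightarrow> operand \<Rightarrow> complex" where
  "opval vs (Cst c) = of_int c"
| "opval vs (Val i) = vs ! i"

fun run :: "qtree \<Rightarrow> complex list \<Rightarrow> complex list" where
  "run Leaf vs = vs"
| "run (Add a b t) vs = run t (vs @ [opval vs a + opval vs b])"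
| "run (Sub a b t) vs = run t (vs @ [opval vs a - opval vs b])"
| "run (Mul a b t) vs = run t (vs @ [opval vs a * opval vs b])"
| "run (Dv a b t) vs = run t (vs @ [opval vs a / opval vs b])"
| "run (Sqrt i t) vs = run t (vs @ [csqrt (vs ! i)])"
| "run (Conj i t) vs = run t (vs @ [cnj (vs ! i)])"
| "run (Test i t1 t2) vs =
     (if Im (vs ! i) = 0 \<and> Re (vs ! i) > 0 then run t1 vs else run t2 vs)"

definition qtree_computes :: "qtree \<Rightarrow> nat set \<Rightarrow> (nat \<Rightarrow> complex) \<Rightarrow> bool" where
  "qtree_computes T V p \<longleftrightarrow> wf_qtree 0 T \<and> (\<forall>v\<in>V. p v \<in> set (run T []))"

definition simple_graph :: "nat set \<Rightarrow> (nat \<Rightarrow> nat \<Rightarrow> bool) \<Rightarrow> bool" where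
  "simple_graph V E \<longleftrightarrow> (\<forall>u v. E u v \<longrightarrow> u \<in> V \<and> v \<in> V \<and> u \<noteq> v \<and> E v u)"

definition congruent_drawing :: "nat set \<Rightarrow> (nat \<Rightarrow> complex) \<Rightarrow> (nat \<Rightarrow> complex) \<Rightarrow> bool" where
  "congruent_drawing V p q \<longleftrightarrow>
     (\<exists>a b. cmod a = 1 \<and>
        ((\<forall>v\<in>V. q v = a * p v + b) \<or> (\<forall>v\<in>V. q v = a * cnj (p v) + b)))"

section \<open>Fruchterman--Reingold equilibria (k = 1)\<close>

definition FR_equilibrium :: "nat set \<Rightarrow> (nat \<Rightarrow> nat \<Rightarrow> bool) \<Rightarrow> (nat \<Rightarrow> complex) \<Rightarrow> bool" where
  "FR_equilibrium V E p \<longleftrightarrow> inj_on p V \<and>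
     (\<forall>v\<in>V.
        (\<Sum>u\<in>{u\<in>V. E v u}. of_real ((cmod (p u - p v))^2) * ((p u - p v) / of_real (cmod (p u - p v))))
      + (\<Sum>w\<in>V - {v}. of_real (1 / cmod (p v - p w)) * ((p v - p w) / of_real (cmod (p v - p w))))
      = 0)"

section \<open>Kamada--Kawai equilibria (L = K = 1)\<close>

fun walk :: "nat set \<Rightarrow> (nat \<Rightarrow> nat \<Rightarrow> bool) \<Rightarrow> nat \<Rightarrow> nat \<Rightarrow> nat \<Rightarrow> bool" where
  "walk V E 0 i j = (i = j)"
| "walk V E (Suc n) i j = (\<exists>k\<in>V. E i k \<and> walk V E n k j)"

definition connected_graph :: "nat set \<Rightarrow> (nat \<Rightarrow> nat \<Rightarrow> bool) \<Rightarrow> bool" where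
  "connected_graph V E \<longleftrightarrow> (\<forall>i\<in>V. \<forall>j\<in>V. \<exists>n. walk V E n i j)"

definition gdist :: "nat set \<Rightarrow> (nat \<Rightarrow> nat \<Rightarrow> bool) \<Rightarrow> nat \<Rightarrow> nat \<Rightarrow> nat" where
  "gdist V E i j = (LEAST n. walk V E n i j)"

definition KK_energy :: "nat set \<Rightarrow> (nat \<Rightarrow> nat \<Rightarrow> bool) \<Rightarrow> (nat \<Rightarrow> complex) \<Rightarrow> real" where
  "KK_energy V E q =
     (\<Sum>i\<in>V. \<Sum>j\<in>{j\<in>V. i < j}.
        1/2 * (1 / (real (gdist V E i j))^2) * (cmod (q i - q j) - real (gdist V E i j))^2)"

definition KK_equilibrium :: "nat set \<Rightarrow> (nat \<Rightarrow> nat \<Rightarrow> bool) \<Rightarrow> (nat \<Rightarrow> complex) \<Rightarrow> bool" where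
  "KK_equilibrium V E p \<longleftrightarrow> connected_graph V E \<and>
     (\<exists>\<epsilon>>0. \<forall>q. (\<forall>v\<in>V. cmod (q v - p v) < \<epsilon>) \<longrightarrow> KK_energy V E p \<le> KK_energy V E q)"

end

theory Submission
  imports Defs
begin

text \<open>The graph is the cycle $C_7$, and in both models a regular heptagon is an equilibrium.
  Ratios of edge vectors of any congruent copy give $\zeta = e^{2\pi i/7}$ or its conjugate,
  and $\zeta + 1/\zeta$ is a root of the cubic $t^3 + t^2 - 2t - 1$, which has no rational root
  and therefore none in a field obtained by repeatedly adjoining square roots.

  For Fruchterman--Reingold the two forces are radial by symmetry and balance at one scale.
  For Kamada--Kawai the heptagon of the critical scale is even a global minimum: with
  $r$ a chord length and $d$ the graph distance,
  $(x-d)^2 - (r-d)^2 \ge (1 - d/r)(x^2 - r^2)$, so the energy difference is bounded below by the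
  quadratic form of the equilibrium stress. This form is circulant, hence diagonal in the
  discrete Fourier basis, and its eigenvalues are nonnegative.\<close>

section \<open>Cubics without roots in quadratic towers\<close>

text \<open>Since x / 0 = 0, closure under division can be asked of all pairs, and it then also
  covers \<open>Dv\<close> nodes that divide by zero.\<close>

definition complex_subfield :: "complex set \<Rightarrow> bool" where
  "complex_subfield K \<longleftrightarrow> \<int> \<subseteq> K \<and>
     (\<forall>x\<in>K. \<forall>y\<in>K. x + y \<in> K \<and> x - y \<in> K \<and> x * y \<in> K \<and> x / y \<in> K)"

text \<open>For \<open>s ^ 2\<close> in \<open>K\<close> this is the field K(s), of degree at most 2
  over \<open>K\<close>.\<close>

definition adjoin :: "complex set \<Rightarrow> complex \<Rightarrow> complex set" where
  "adjoin K s = {u + v * s | u v. u \<in> K \<and> v \<in> K}"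

definition cubic :: "int \<Rightarrow> int \<Rightarrow> int \<Rightarrow> complex \<Rightarrow> complex" where
  "cubic b c d x = x ^ 3 + of_int b * x ^ 2 + of_int c * x + of_int d"

lemma complex_subfieldD:
  assumes "complex_subfield K"
  shows "of_int n \<in> K" "numeral w \<in> K" "0 \<in> K" "1 \<in> K"
    and "x \<in> K \<Longrightarrow> y \<in> K \<Longrightarrow> x + y \<in> K"
    and "x \<in> K \<Longrightarrow> y \<in> K \<Longrightarrow> x - y \<in> K"
    and "x \<in> K \<Longrightarrow> y \<in> K \<Longrightarrow> x * y \<in> K"
    and "x \<in> K \<Longrightarrow> y \<in> K \<Longrightarrow> x / y \<in> K"
    and "x \<in> K \<Longrightarrow> - x \<in> K"
    and "x \<in> K \<Longrightarrow> x ^ k \<in> K"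
proof -
  have Z: "\<int> \<subseteq> K" and cl: "\<And>x y. x \<in> K \<Longrightarrow> y \<in> K \<Longrightarrow> x + y \<in> K \<and> x - y \<in> K \<and> x * y \<in> K \<and> x / y \<in> K"
    using assms unfolding complex_subfield_def by auto
  show z: "of_int n \<in> K" "numeral w \<in> K" "0 \<in> K" "1 \<in> K"
    using Z by auto
  show "x \<in> K \<Longrightarrow> y \<in> K \<Longrightarrow> x + y \<in> K"
    and "x \<in> K \<Longrightarrow> y \<in> K \<Longrightarrow> x - y \<in> K"
    and "x \<in> K \<Longrightarrow> y \<in> K \<Longrightarrow> x * y \<in> K"
    and "x \<in> K \<Longrightarrow> y \<in> K \<Longrightarrow> x / y \<in> K"
    using cl by auto
  show "x \<in> K \<Longrightarrow> - x \<in> K"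
    using cl[of 0 x] z by simp
  show "x \<in> K \<Longrightarrow> x ^ k \<in> K"
    by (induction k) (use z cl in auto)
qed

lemma adjoin_memI: "u \<in> K \<Longrightarrow> v \<in> K \<Longrightarrow> u + v * s \<in> adjoin K s"
  unfolding adjoin_def by blast

lemma subset_adjoin: "complex_subfield K \<Longrightarrow> K \<subseteq> adjoin K s"
  using adjoin_memI[of _ K 0 s] complex_subfieldD(3) by fastforce

lemma gen_in_adjoin: "complex_subfield K \<Longrightarrow> s \<in> adjoin K s"
  using adjoin_memI[of 0 K 1 s] complex_subfieldD(3,4) by fastforce

lemma adjoin_trivial:
  assumes "complex_subfield K" "s \<in> K"
  shows "adjoin K s = K"
  using subset_adjoin[OF assms(1), of s] complex_subfieldD[OF assms(1)] assms(2)
  unfolding adjoin_def by auto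

text \<open>Products stay inside because \<open>s ^ 2\<close> is in \<open>K\<close>. Inverses come
  from rationalising the denominator with the norm (u + v s)(u - v s), which lies in
  \<open>K\<close>.\<close>

lemma complex_subfield_adjoin:
  assumes K: "complex_subfield K" and a: "s ^ 2 \<in> K"
  shows "complex_subfield (adjoin K s)"
proof (cases "s \<in> K")
  case True
  then show ?thesis using adjoin_trivial K by simp
next
  case False
  note [intro] = complex_subfieldD[OF K]
  have add: "x + y \<in> adjoin K s" and diff: "x - y \<in> adjoin K s"
    and mult: "x * y \<in> adjoin K s"
    if xy: "x \<in> adjoin K s" "y \<in> adjoin K s" for x y
  proof -
    obtain u v u' v' where uv: "x = u + v * s" "y = u' + v' * s" "u \<in> K" "v \<in> K" "u' \<in> K" "v' \<in> K"
      using xy unfolding adjoin_def by blast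
    have eq: "x + y = (u + u') + (v + v') * s" "x - y = (u - u') + (v - v') * s"
      "x * y = (u * u' + v * v' * s ^ 2) + (u * v' + v * u') * s"
      using uv by (auto simp: algebra_simps power2_eq_square)
    show "x + y \<in> adjoin K s" "x - y \<in> adjoin K s" "x * y \<in> adjoin K s"
      unfolding eq using uv a by (blast intro: adjoin_memI)+
  qed
  have inv: "1 / y \<in> adjoin K s" if y: "y \<in> adjoin K s" for y
  proof -
    obtain u v where uv: "y = u + v * s" "u \<in> K" "v \<in> K"
      using y unfolding adjoin_def by blast
    let ?N = "u ^ 2 - v ^ 2 * s ^ 2"
    show ?thesis
    proof (cases "?N = 0")
      case True
      \<comment> \<open>A vanishing norm with v nonzero would make s equal to u/v or -u/v, hence an
        element of \<open>K\<close>. So u = v = 0, and the inverse of y = 0 is 0 by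
        convention.\<close>
      have "v = 0"
      proof (rule ccontr)
        assume v: "v \<noteq> 0"
        have "(s - u / v) * (s + u / v) = 0"
          using True v by (simp add: field_simps power2_eq_square)
        then have "s = u / v \<or> s = - (u / v)" by (auto simp: add_eq_0_iff)
        then show False using \<open>s \<notin> K\<close> uv by auto
      qed
      then have "y = 0" using True uv by simp
      then show ?thesis using subset_adjoin[OF K] by auto
    next
      case False
      have f: "?N = (u + v * s) * (u - v * s)"
        by (simp add: algebra_simps power2_eq_square)
      then have nz: "u + v * s \<noteq> 0" "u - v * s \<noteq> 0" using False by auto
      have "1 / y = (u - v * s) / ?N"
        unfolding f uv(1) using nz by simp
      also have "\<dots> = u / ?N + (- v / ?N) * s"
        by (simp add: diff_divide_distrib)
      finally have eq: "1 / y = u / ?N + (- v / ?N) * s" .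
      have "?N \<in> K" using uv a by blast
      then show ?thesis
        unfolding eq using uv
        by (intro adjoin_memI complex_subfieldD(8)[OF K] complex_subfieldD(9)[OF K])
    qed
  qed
  have "x / y \<in> adjoin K s" if "x \<in> adjoin K s" "y \<in> adjoin K s" for x y
    using mult[OF that(1) inv[OF that(2)]] by simp
  moreover have "\<int> \<subseteq> adjoin K s"
    using K subset_adjoin[OF K] unfolding complex_subfield_def by blast
  ultimately show ?thesis using add diff mult by (simp add: complex_subfield_def)
qed

text \<open>If $u + vs$ is a root, so is its conjugate $u - vs$, and the third root is
  $-b - 2u$ by Vieta.\<close>
lemma cubic_rootfree_adjoin:
  assumes K: "complex_subfield K" and a: "s ^ 2 \<in> K"
    and free: "\<forall>x\<in>K. cubic b c d x \<noteq> 0"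
  shows "\<forall>x\<in>adjoin K s. cubic b c d x \<noteq> 0"
proof (cases "s \<in> K")
  case True
  then show ?thesis using adjoin_trivial K free by simp
next
  case False
  note [intro] = complex_subfieldD[OF K]
  show ?thesis
  proof
    fix x assume "x \<in> adjoin K s"
    then obtain u v where uv: "x = u + v * s" "u \<in> K" "v \<in> K"
      unfolding adjoin_def by blast
    show "cubic b c d x \<noteq> 0"
    proof
      assume root: "cubic b c d x = 0"
      \<comment> \<open>The cubic at u + v s, expanded and sorted by the parity of the power of s,
        is P + (v Q) s with P and v Q in \<open>K\<close>. As s is outside \<open>K\<close>, both
        coefficients vanish.\<close>
      define P where "P = u ^ 3 + 3 * u * v ^ 2 * s ^ 2 + of_int b * (u ^ 2 + v ^ 2 * s ^ 2)
        + of_int c * u + of_int d"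
      define Q where "Q = 3 * u ^ 2 + v ^ 2 * s ^ 2 + 2 * of_int b * u + of_int c"
      have PQ: "P \<in> K" "v * Q \<in> K" unfolding P_def Q_def using uv a by blast+
      have eq: "P + v * Q * s = 0"
        using root unfolding cubic_def uv(1) P_def Q_def
        by (simp add: algebra_simps power2_eq_square power3_eq_cube)
      have vQ: "v * Q = 0"
      proof (rule ccontr)
        assume nz: "v * Q \<noteq> 0"
        have "s = - P / (v * Q)"
          using eq nz by (simp add: field_simps eq_neg_iff_add_eq_0)
        then show False using \<open>s \<notin> K\<close> PQ by auto
      qed
      have v: "v \<noteq> 0" using root free uv by auto
      have "Q = 0" using vQ v by simp
      then have vs: "v ^ 2 * s ^ 2 = - 3 * u ^ 2 - 2 * of_int b * u - of_int c"
        unfolding Q_def by algebra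
      have "P = u ^ 3 + 3 * u * (v ^ 2 * s ^ 2) + of_int b * (u ^ 2 + v ^ 2 * s ^ 2)
        + of_int c * u + of_int d"
        unfolding P_def by (simp add: algebra_simps)
      \<comment> \<open>Eliminating v^2 s^2 by Q = 0 turns P into the value of the cubic at the
        third root, which lies in \<open>K\<close>.\<close>
      also have "\<dots> = cubic b c d (- of_int b - 2 * u)"
        unfolding vs cubic_def by (simp add: algebra_simps power2_eq_square power3_eq_cube)
      finally have "cubic b c d (- of_int b - 2 * u) = 0" using eq vQ by simp
      then show False using free uv by blast
    qed
  qed
qed

text \<open>The invariant for the values on a path of the tree; closure under \<open>cnj\<close>
  takes care of the \<open>Conj\<close> nodes.\<close>

definition rootfree_field :: "int \<Rightarrow> int \<Rightarrow> int \<Rightarrow> complex set \<Rightarrow> bool" where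
  "rootfree_field b c d K \<longleftrightarrow>
     complex_subfield K \<and> (\<forall>x\<in>K. cnj x \<in> K) \<and> (\<forall>x\<in>K. cubic b c d x \<noteq> 0)"

text \<open>Adjoining both conjugate square roots keeps the field closed under conjugation.\<close>
lemma rootfree_field_sqrt:
  assumes K: "rootfree_field b c d K" and a: "s ^ 2 \<in> K"
  shows "\<exists>K'. rootfree_field b c d K' \<and> K \<subseteq> K' \<and> s \<in> K'"
proof -
  define L where "L = adjoin K s"
  define M where "M = adjoin L (cnj s)"
  have K1: "complex_subfield K" and K2: "\<And>x. x \<in> K \<Longrightarrow> cnj x \<in> K"
    and K3: "\<forall>x\<in>K. cubic b c d x \<noteq> 0"
    using K unfolding rootfree_field_def by auto
  have L1: "complex_subfield L" and L3: "\<forall>x\<in>L. cubic b c d x \<noteq> 0"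
    unfolding L_def
    using complex_subfield_adjoin[OF K1 a] cubic_rootfree_adjoin[OF K1 a K3] by auto
  have sub: "K \<subseteq> L" "L \<subseteq> M" "s \<in> L" "cnj s \<in> M"
    unfolding L_def M_def using subset_adjoin gen_in_adjoin K1 L1 L_def by auto
  have "cnj s ^ 2 = cnj (s ^ 2)" by simp
  \<comment> \<open>The square of \<open>cnj s\<close> is the conjugate of an element of
    \<open>K\<close>, so the second extension is quadratic as well.\<close>
  then have a': "cnj s ^ 2 \<in> L" using K2[OF a] sub by auto
  have M1: "complex_subfield M" and M3: "\<forall>x\<in>M. cubic b c d x \<noteq> 0"
    unfolding M_def
    using complex_subfield_adjoin[OF L1 a'] cubic_rootfree_adjoin[OF L1 a' L3] by auto
  note M = complex_subfieldD[OF M1]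
  have cL: "cnj x \<in> M" if x: "x \<in> L" for x
  proof -
    obtain u v where uv: "x = u + v * s" "u \<in> K" "v \<in> K"
      using x unfolding L_def adjoin_def by blast
    then have "cnj u \<in> M" "cnj v \<in> M" using K2 sub by blast+
    then show ?thesis using sub M(5,7) by (simp add: uv(1))
  qed
  have "cnj x \<in> M" if x: "x \<in> M" for x
  proof -
    obtain u v where uv: "x = u + v * cnj s" "u \<in> L" "v \<in> L"
      using x unfolding M_def adjoin_def by blast
    moreover have "s \<in> M" using sub by blast
    ultimately show ?thesis using cL M(5,7) by (simp add: uv(1))
  qed
  then show ?thesis using M1 M3 sub unfolding rootfree_field_def by blast
qed

section \<open>Values computed along a path of the tree\<close>

lemma opval_in_subfield:
  "complex_subfield K \<Longrightarrow> set vs \<subseteq> K \<Longrightarrow> op_ok (length vs) x \<Longrightarrow> opval vs x \<in> K"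
  by (cases x) (auto simp: subset_iff complex_subfieldD(1))

text \<open>Only \<open>Sqrt\<close> nodes enlarge the field. Arithmetic and conjugation stay inside
  it, and a \<open>Test\<close> merely selects the subtree that is run.\<close>

lemma qtree_values_in_rootfree_field:
  assumes "rootfree_field b c d K" "set vs \<subseteq> K" "wf_qtree (length vs) T"
  shows "\<exists>K'. rootfree_field b c d K' \<and> set (run T vs) \<subseteq> K'"
  using assms
proof (induction T arbitrary: K vs)
  case Leaf
  then show ?case by auto
next
  case (Sqrt i T)
  then obtain K' where K': "rootfree_field b c d K'" "K \<subseteq> K'" "csqrt (vs ! i) \<in> K'"
    using rootfree_field_sqrt[of b c d K "csqrt (vs ! i)"] by (auto simp: subset_iff)
  show ?case
    using Sqrt.IH[OF K'(1), of "vs @ [csqrt (vs ! i)]"] Sqrt.prems K' by auto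
next
  case (Conj i T)
  then have "cnj (vs ! i) \<in> K" unfolding rootfree_field_def by (auto simp: subset_iff)
  then show ?case
    using Conj.IH[OF Conj.prems(1), of "vs @ [cnj (vs ! i)]"] Conj.prems by auto
next
  case (Test i T1 T2)
  then show ?case by auto
next
  case (Add x y T)
  then have "opval vs x + opval vs y \<in> K"
    using opval_in_subfield complex_subfieldD unfolding rootfree_field_def by auto
  then show ?case
    using Add.IH[OF Add.prems(1), of "vs @ [opval vs x + opval vs y]"] Add.prems by auto
next
  case (Sub x y T)
  then have "opval vs x - opval vs y \<in> K"
    using opval_in_subfield complex_subfieldD unfolding rootfree_field_def by auto
  then show ?case
    using Sub.IH[OF Sub.prems(1), of "vs @ [opval vs x - opval vs y]"] Sub.prems by auto
next
  case (Mul x y T)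
  then have "opval vs x * opval vs y \<in> K"
    using opval_in_subfield complex_subfieldD unfolding rootfree_field_def by auto
  then show ?case
    using Mul.IH[OF Mul.prems(1), of "vs @ [opval vs x * opval vs y]"] Mul.prems by auto
next
  case (Dv x y T)
  then have "opval vs x / opval vs y \<in> K"
    using opval_in_subfield complex_subfieldD unfolding rootfree_field_def by auto
  then show ?case
    using Dv.IH[OF Dv.prems(1), of "vs @ [opval vs x / opval vs y]"] Dv.prems by auto
qed

text \<open>Clearing denominators, a fraction in lowest terms would make the integer
  $a^3 + a^2 b - 2 a b^2 - b^3$ odd.\<close>
lemma rootfree_field_Rats: "rootfree_field 1 (-2) (-1) \<rat>"
proof -
  have "cubic 1 (-2) (-1) x \<noteq> 0" if x_rat: "x \<in> \<rat>" for x
  proof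
    assume root: "cubic 1 (-2) (-1) x = 0"
    obtain r :: rat where "x = of_rat r" using x_rat unfolding Rats_def by blast
    moreover obtain a b where r: "r = Fract a b" "b > 0" "coprime a b"
      by (cases r) auto
    ultimately have x: "x = of_int a / of_int b" by (simp add: of_rat_rat)
    have "of_int (a ^ 3 + a ^ 2 * b - 2 * a * b ^ 2 - b ^ 3) = of_int b ^ 3 * cubic 1 (-2) (-1) x"
      using r(2) unfolding cubic_def x
      by (simp add: field_simps power2_eq_square power3_eq_cube)
    then have eq: "a ^ 3 + a ^ 2 * b - 2 * a * b ^ 2 - b ^ 3 = 0"
      by (simp only: root mult_zero_right of_int_eq_0_iff)
    have "even (a ^ 3 + a ^ 2 * b - 2 * a * b ^ 2 - b ^ 3)" unfolding eq by simp
    then have "even a \<and> even b" by auto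
    then have "\<not> coprime a b" using not_coprimeI[of 2 a b] by auto
    then show False using r by simp
  qed
  moreover have "cnj x \<in> \<rat>" if x_rat: "x \<in> \<rat>" for x
  proof -
    obtain a b :: int where "x = of_int a / of_int b"
      using x_rat by (auto elim: Rats_cases')
    then have "cnj x = x" by simp
    then show ?thesis using x_rat by simp
  qed
  moreover have "complex_subfield \<rat>"
    unfolding complex_subfield_def using Ints_subset_Rats by auto
  ultimately show ?thesis unfolding rootfree_field_def by auto
qed

section \<open>Seventh roots of unity\<close>

abbreviation zeta :: complex where
  "zeta \<equiv> cis (2 * pi / 7)"

lemma zeta_power: "zeta ^ k = cis (2 * pi * real k / 7)"
  by (simp add: DeMoivre algebra_simps)

lemma zeta_7: "zeta ^ 7 = 1"
  by (simp add: zeta_power)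

lemma zeta_power_mod: "zeta ^ (k mod 7) = zeta ^ k"
proof -
  have "zeta ^ k = zeta ^ (7 * (k div 7) + k mod 7)" by simp
  also have "\<dots> = zeta ^ (k mod 7)" by (simp only: power_add power_mult zeta_7) simp
  finally show ?thesis by simp
qed

lemma zeta_power_inj: "inj_on (\<lambda>k. zeta ^ k) {..<7}"
  using bij_betw_roots_unity[of 7] unfolding bij_betw_def zeta_power by simp

lemma zeta_power_neq_1: "0 < k \<Longrightarrow> k < 7 \<Longrightarrow> zeta ^ k \<noteq> 1"
  using inj_onD[OF zeta_power_inj, of k 0] by auto

lemma zeta_power_sum:
  assumes "0 < k" "k < 7"
  shows "(\<Sum>j<7. (zeta ^ k) ^ j) = 0"
proof -
  have "(zeta ^ k) ^ 7 = (zeta ^ 7) ^ k" by (simp only: mult.commute flip: power_mult)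
  then have "(zeta ^ k) ^ 7 = 1" by (simp only: zeta_7 power_one)
  then show ?thesis using zeta_power_neq_1[OF assms] by (simp add: geometric_sum)
qed

lemma zeta_nz: "zeta \<noteq> 0" by (simp add: cis_neq_zero)

text \<open>Multiplying by \<open>zeta ^ 3\<close> turns the cubic into 1 + zeta + ... + zeta^6, a
  vanishing geometric sum.\<close>

lemma zeta_cubic: "cubic 1 (-2) (-1) (zeta + 1 / zeta) = 0"
proof -
  have "zeta ^ 3 * cubic 1 (-2) (-1) (zeta + 1 / zeta) = (\<Sum>j<7. zeta ^ j)"
    unfolding cubic_def using zeta_nz
    by (simp add: field_simps eval_nat_numeral)
  also have "\<dots> = 0" using zeta_power_sum[of 1] by simp
  finally show ?thesis using zeta_nz by simp
qed

lemma heptagon_not_computable: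
  assumes s: "s \<noteq> 0" and q: "congruent_drawing {..<7} (\<lambda>v. of_real s * zeta ^ v) q"
  shows "\<not> qtree_computes T {..<7} q"
proof
  assume "qtree_computes T {..<7} q"
  then have wf: "wf_qtree 0 T" and mem: "\<And>v. v < 7 \<Longrightarrow> q v \<in> set (run T [])"
    unfolding qtree_computes_def by auto
  obtain K where K: "rootfree_field 1 (-2) (-1) K" "set (run T []) \<subseteq> K"
    using qtree_values_in_rootfree_field[OF rootfree_field_Rats, of "[]" T] wf by auto
  have K1: "complex_subfield K" and K2: "\<forall>x\<in>K. cubic 1 (-2) (-1) x \<noteq> 0"
    using K(1) unfolding rootfree_field_def by auto
  note [intro] = complex_subfieldD[OF K1]
  \<comment> \<open>The ratio of consecutive edge vectors does not see translation, rotation or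
    scale. It is \<open>zeta\<close>, or \<open>cnj zeta\<close> = 1 / \<open>zeta\<close> for a
    reflected copy, so w + 1/w is the same in both cases.\<close>
  define w where "w = (q 2 - q 1) / (q 1 - q 0)"
  have "q 0 \<in> K" "q 1 \<in> K" "q 2 \<in> K" using mem K(2) by auto
  then have w: "w \<in> K" unfolding w_def by blast
  obtain a b where a: "cmod a = 1" and
    ab: "(\<forall>v<7. q v = a * (of_real s * zeta ^ v) + b) \<or>
         (\<forall>v<7. q v = a * cnj (of_real s * zeta ^ v) + b)"
    using q unfolding congruent_drawing_def by auto
  have anz: "a \<noteq> 0" using a by auto
  have z1: "zeta \<noteq> 1" using zeta_power_neq_1[of 1] by simp
  then have z2: "cnj zeta \<noteq> 1" by (metis complex_cnj_cnj complex_cnj_one)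
  have inv: "1 / zeta = cnj zeta" by (simp add: cis_cnj cis_divide[of 0, simplified])
  have "w + 1 / w = zeta + 1 / zeta"
    using ab
  proof
    assume h: "\<forall>v<7. q v = a * (of_real s * zeta ^ v) + b"
    have "w = (a * of_real s * (zeta - 1) * zeta) / (a * of_real s * (zeta - 1))"
      unfolding w_def using h by (simp add: algebra_simps power2_eq_square del: cis_mult)
    also have "\<dots> = zeta" using anz s z1 by simp
    finally show ?thesis by simp
  next
    assume h: "\<forall>v<7. q v = a * cnj (of_real s * zeta ^ v) + b"
    have "w = (a * of_real s * (cnj zeta - 1) * cnj zeta) / (a * of_real s * (cnj zeta - 1))"
      unfolding w_def using h by (simp add: algebra_simps power2_eq_square del: cis_mult cis_cnj)
    also have "\<dots> = cnj zeta" using anz s z2 by simp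
    finally show ?thesis using zeta_nz by (simp flip: inv)
  qed
  moreover have "w + 1 / w \<in> K" using w by blast
  ultimately show False using K2 zeta_cubic by auto
qed


lemma zeta_power_compl: "k \<le> 7 \<Longrightarrow> zeta ^ (7 - k) = cnj (zeta ^ k)"
proof -
  assume "k \<le> 7"
  then have "zeta ^ (7 - k) * zeta ^ k = 1" by (simp add: zeta_7 flip: power_add del: cis_mult)
  moreover have "cnj (zeta ^ k) * zeta ^ k = 1"
    by (simp only: zeta_power cis_cnj cis_mult) simp
  ultimately show ?thesis using zeta_nz by (metis mult_right_cancel power_not_zero)
qed

lemma cmod_zeta_power: "cmod (zeta ^ k) = 1"
  by (simp add: norm_power)

section \<open>The seven-cycle\<close>

definition C7 :: "nat \<Rightarrow> nat \<Rightarrow> bool" where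
  "C7 u v \<longleftrightarrow> u < 7 \<and> v < 7 \<and> (v = (u + 1) mod 7 \<or> u = (v + 1) mod 7)"

lemma mod_7_below_14: "n < 14 \<Longrightarrow> n mod 7 = (if n < 7 then n else n - (7::nat))"
  by (simp add: mod_if)

lemma simple_graph_C7: "simple_graph {..<7} C7"
proof -
  have "u \<noteq> v" if "C7 u v" for u v
    using that unfolding C7_def by (auto simp: mod_7_below_14 split: if_splits)
  moreover have "u < 7 \<and> v < 7 \<and> C7 v u" if "C7 u v" for u v
    using that unfolding C7_def by blast
  ultimately show ?thesis unfolding simple_graph_def by blast
qed

text \<open>Numbers the other vertices by their rotation relative to \<open>v\<close>, so that a sum
  over them can be treated alike for every \<open>v\<close>.\<close>

lemma bij_betw_shift_mod_7:
  assumes "v < (7::nat)"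
  shows "bij_betw (\<lambda>m. (v + m) mod 7) {1..<7} ({..<7} - {v})"
  unfolding bij_betw_def
proof
  show "inj_on (\<lambda>m. (v + m) mod 7) {1..<7}"
  proof (rule inj_onI)
    fix x y assume "x \<in> {1..<7}" "y \<in> {1..<7}" "(v + x) mod 7 = (v + y) mod 7"
    then show "x = y" using assms by (auto simp: mod_7_below_14 split: if_splits)
  qed
  show "(\<lambda>m. (v + m) mod 7) ` {1..<7} = {..<7} - {v}"
  proof (intro equalityI subsetI)
    fix w assume "w \<in> (\<lambda>m. (v + m) mod 7) ` {1..<7}"
    then show "w \<in> {..<7} - {v}" using assms by (auto simp: mod_7_below_14 split: if_splits)
  next
    fix w assume "w \<in> {..<7} - {v}"
    then have "\<exists>m\<in>{1..<7}. w = (v + m) mod 7"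
      using assms
      by (intro bexI[of _ "if v < w then w - v else w + 7 - v"]) (auto simp: mod_7_below_14)
    then show "w \<in> (\<lambda>m. (v + m) mod 7) ` {1..<7}" by blast
  qed
qed

lemma C7_neighbours:
  assumes "v < 7"
  \<comment> \<open>Adding 6 stands for subtracting 1 modulo 7, which avoids truncated
    subtraction.\<close>
  shows "{u \<in> {..<7}. C7 v u} = {(v + 1) mod 7, (v + 6) mod 7}"
proof -
  have "v = (u + 1) mod 7 \<longleftrightarrow> u = (v + 6) mod 7" if "u < 7" for u
    using assms that by (simp add: mod_7_below_14) arith
  then show ?thesis using assms by (auto simp: C7_def)
qed

section \<open>The Fruchterman--Reingold heptagon\<close>

text \<open>The terms for m and 7 - m are 1/(1 - 1/x) and 1/(1 - x) with x =
  \<open>zeta ^ m\<close>. They add up to 1, and there are three such pairs.\<close>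

lemma sum_inverse_one_minus_zeta: "(\<Sum>m\<in>{1..<7}. 1 / (1 - cnj (zeta ^ m))) = 3"
proof -
  define h where "h = (\<lambda>m. 1 / (1 - cnj (zeta ^ m)))"
  have pair: "h m + h (7 - m) = 1"
    if m: "0 < m" "m < 7" for m
  proof -
    have "cnj (zeta ^ m) * zeta ^ m = 1"
      by (simp only: zeta_power cis_cnj cis_mult) simp
    then have x: "cnj (zeta ^ m) = 1 / zeta ^ m"
      using zeta_nz by (simp add: field_simps)
    have "zeta ^ m \<noteq> 1" "zeta ^ m \<noteq> 0" using zeta_power_neq_1 m zeta_nz by auto
    then have "1 / (1 - 1 / zeta ^ m) + 1 / (1 - zeta ^ m) = 1"
      by (simp add: divide_simps) (simp add: algebra_simps)
    moreover have "cnj (zeta ^ (7 - m)) = zeta ^ m"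
      using m by (simp only: zeta_power_compl complex_cnj_cnj less_imp_le)
    ultimately show ?thesis by (simp only: h_def x)
  qed
  have "{1..<7::nat} = {1,2,3,4,5,6}" by auto
  then have "sum h {1..<7} = (h 1 + h (7 - 1)) + (h 2 + h (7 - 2)) + (h 3 + h (7 - 3))"
    by (simp add: algebra_simps)
  also have "\<dots> = 3" using pair[of 1] pair[of 2] pair[of 3] by simp
  finally show ?thesis unfolding h_def .
qed

text \<open>With c the side of the unit heptagon, attraction is -s c^3 and repulsion 3 / s^2 times
  the position vector. They cancel when the side length s c has cube 3, which fixes
  \<open>s\<close>.\<close>

lemma FR_heptagon:
  defines "s \<equiv> root 3 3 / cmod (zeta - 1)"
  shows "FR_equilibrium {..<7} C7 (\<lambda>v. of_real s * zeta ^ v)" and "s > 0"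
proof -
  define c where "c = cmod (zeta - 1)"
  have c: "c > 0" using zeta_power_neq_1[of 1] unfolding c_def by simp
  show s: "s > 0" unfolding s_def using c c_def by simp
  have sc: "(s * c) ^ 3 = 3" unfolding s_def using c c_def by simp
  define p where "p = (\<lambda>v. complex_of_real s * zeta ^ v)"
  have p_shift: "p ((v + m) mod 7) = p v * zeta ^ m" for v m
    unfolding p_def zeta_power_mod by (simp add: power_add)
  have pnz: "p v \<noteq> 0" for v unfolding p_def using s zeta_nz by simp
  have norm_p: "cmod (p v) = s" for v
    unfolding p_def norm_mult cmod_zeta_power using s by simp
  have cnj_p: "cnj (p v) = of_real (s ^ 2) / p v" for v
    using complex_norm_square[of "p v"] pnz[of v] by (simp add: field_simps norm_p)
  \<comment> \<open>Both forces lose their unit vectors: attraction becomes |z| z and repulsion 1 /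
    \<open>cnj z\<close>. At z = 0 both sides are 0 by the convention for division.\<close>
  have attr: "of_real ((cmod z) ^ 2) * (z / of_real (cmod z)) = of_real (cmod z) * z" for z
    by (simp add: power2_eq_square)
  have rep: "of_real (1 / cmod z) * (z / of_real (cmod z)) = 1 / cnj z" for z
  proof (cases "z = 0")
    case False
    then show ?thesis
      using complex_norm_square[of z] by (simp add: field_simps power2_eq_square)
  qed simp
  have attraction:
    "(\<Sum>u\<in>{u \<in> {..<7}. C7 v u}. of_real ((cmod (p u - p v))^2) * ((p u - p v) / of_real (cmod (p u - p v))))
      = - of_real (s * c ^ 3) * p v" if v: "v < 7" for v
  proof -
    have z6: "zeta ^ 6 = cnj zeta" using zeta_power_compl[of 1] by simp
    have n: "cmod (p v * zeta - p v) = s * c" "cmod (p v * cnj zeta - p v) = s * c"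
    proof -
      have "p v * zeta - p v = p v * (zeta - 1)" "p v * cnj zeta - p v = p v * cnj (zeta - 1)"
        by (simp_all add: algebra_simps)
      then show "cmod (p v * zeta - p v) = s * c" "cmod (p v * cnj zeta - p v) = s * c"
        by (simp_all only: norm_mult norm_p complex_mod_cnj c_def)
    qed
    have "(v + 1) mod 7 \<noteq> (v + 6) mod 7" using v by (auto simp: mod_7_below_14)
    then have "(\<Sum>u\<in>{u \<in> {..<7}. C7 v u}. of_real ((cmod (p u - p v))^2) * ((p u - p v) / of_real (cmod (p u - p v))))
        = of_real (s * c) * (p v * zeta - p v) + of_real (s * c) * (p v * cnj zeta - p v)"
      unfolding C7_neighbours[OF v] attr by (simp add: p_shift[of v 1, simplified] p_shift z6 n del: cis_cnj)
    \<comment> \<open>Because zeta * cnj zeta = 1, the factor zeta + cnj zeta - 2 is -(zeta - 1) *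
      cnj (zeta - 1).\<close>
    also have "\<dots> = - of_real (s * c) * p v * ((zeta - 1) * cnj (zeta - 1))"
    proof -
      have "zeta * cnj zeta = 1" by (simp add: cis_cnj cis_mult)
      then show ?thesis by (simp add: algebra_simps del: cis_cnj)
    qed
    also have "(zeta - 1) * cnj (zeta - 1) = of_real (c ^ 2)"
      unfolding c_def by (rule complex_norm_square[symmetric])
    finally show ?thesis by (simp add: power2_eq_square power3_eq_cube)
  qed
  have repulsion:
    "(\<Sum>w\<in>{..<7} - {v}. of_real (1 / cmod (p v - p w)) * ((p v - p w) / of_real (cmod (p v - p w))))
      = of_real (3 / s ^ 2) * p v" if v: "v < 7" for v
  proof -
    have "(\<Sum>w\<in>{..<7} - {v}. of_real (1 / cmod (p v - p w)) * ((p v - p w) / of_real (cmod (p v - p w))))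
        = (\<Sum>m\<in>{1..<7}. 1 / cnj (p v - p ((v + m) mod 7)))"
      unfolding rep by (rule sum.reindex_bij_betw[OF bij_betw_shift_mod_7[OF v], symmetric])
    also have "\<dots> = (\<Sum>m\<in>{1..<7}. p v / of_real (s ^ 2) * (1 / (1 - cnj (zeta ^ m))))"
    proof (rule sum.cong)
      fix m assume "m \<in> {1..<7::nat}"
      have "cnj (p v - p ((v + m) mod 7)) = cnj (p v) * (1 - cnj (zeta ^ m))"
        unfolding p_shift by (simp add: algebra_simps)
      then show "1 / cnj (p v - p ((v + m) mod 7)) = p v / of_real (s ^ 2) * (1 / (1 - cnj (zeta ^ m)))"
        by (simp add: cnj_p)
    qed simp
    also have "\<dots> = of_real (3 / s ^ 2) * p v"
      unfolding sum_inverse_one_minus_zeta sum_distrib_left[symmetric] by simp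
    finally show ?thesis .
  qed
  have balance: "s * c ^ 3 = 3 / s ^ 2"
    using sc s by (simp add: field_simps power2_eq_square power3_eq_cube)
  have "inj_on p {..<7}"
    using zeta_power_inj s unfolding p_def inj_on_def by simp
  then have "FR_equilibrium {..<7} C7 p"
    unfolding FR_equilibrium_def using attraction repulsion balance by simp
  then show "FR_equilibrium {..<7} C7 (\<lambda>v. of_real s * zeta ^ v)"
    unfolding p_def .
qed

section \<open>Distances in the seven-cycle\<close>

text \<open>This gives the lower bound on distances: every step moves by +1 or -1 modulo 7, and
  signed displacements add up.\<close>

lemma walk_C7_displacement:
  "walk {..<7} C7 n i j \<Longrightarrow> \<exists>z::int. \<bar>z\<bar> \<le> int n \<and> (int i + z) mod 7 = int j mod 7"
proof (induction n arbitrary: i)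
  case 0
  then show ?case by (auto intro: exI[of _ 0])
next
  case (Suc n)
  then obtain k where k: "C7 i k" and "walk {..<7} C7 n k j" by auto
  with Suc.IH obtain z where z: "\<bar>z\<bar> \<le> int n" "(int k + z) mod 7 = int j mod 7"
    by blast
  from k have "k = (i + 1) mod 7 \<or> i = (k + 1) mod 7" unfolding C7_def by auto
  then have "\<exists>e::int. \<bar>e\<bar> = 1 \<and> int k mod 7 = (int i + e) mod 7"
  proof
    assume "k = (i + 1) mod 7"
    then show ?thesis by (intro exI[of _ 1]) (simp add: zmod_int add.commute)
  next
    assume "i = (k + 1) mod 7"
    then show ?thesis by (intro exI[of _ "-1"]) (simp add: zmod_int mod_simps algebra_simps)
  qed
  then obtain e where e: "\<bar>e\<bar> = 1" "int k mod 7 = (int i + e) mod 7" by blast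
  have "(int i + (e + z)) mod 7 = ((int i + e) mod 7 + z) mod 7"
    by (simp add: mod_simps algebra_simps)
  also have "\<dots> = int j mod 7" unfolding e(2)[symmetric] using z(2) by (simp add: mod_simps)
  finally show ?case using e(1) z(1) by (intro exI[of _ "e + z"]) auto
qed

lemma walk_C7_forward: "i < 7 \<Longrightarrow> walk {..<7} C7 n i ((i + n) mod 7)"
proof (induction n arbitrary: i)
  case (Suc n)
  have "walk {..<7} C7 n ((i + 1) mod 7) (((i + 1) mod 7 + n) mod 7)"
    by (rule Suc.IH) simp
  moreover have "((i + 1) mod 7 + n) mod 7 = (i + Suc n) mod 7" by (simp add: mod_simps)
  moreover have "C7 i ((i + 1) mod 7)" using Suc.prems unfolding C7_def by simp
  ultimately show ?case by (auto intro!: bexI[of _ "(i + 1) mod 7"])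
qed simp

text \<open>The summand 6 n represents -n modulo 7.\<close>

lemma walk_C7_backward: "i < 7 \<Longrightarrow> walk {..<7} C7 n i ((i + 6 * n) mod 7)"
proof (induction n arbitrary: i)
  case (Suc n)
  have "walk {..<7} C7 n ((i + 6) mod 7) (((i + 6) mod 7 + 6 * n) mod 7)"
    by (rule Suc.IH) simp
  moreover have "((i + 6) mod 7 + 6 * n) mod 7 = (i + 6 * Suc n) mod 7" by (simp add: mod_simps algebra_simps)
  moreover have "C7 i ((i + 6) mod 7)" using Suc.prems unfolding C7_def by (auto simp: mod_7_below_14)
  ultimately show ?case by (auto intro!: bexI[of _ "(i + 6) mod 7"])
qed simp

lemma connected_C7: "connected_graph {..<7} C7"
  unfolding connected_graph_def
proof (intro ballI)
  fix i j :: nat assume ij: "i \<in> {..<7}" "j \<in> {..<7}"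
  then have "(i + (j + 7 - i)) mod 7 = j" by simp
  then show "\<exists>n. walk {..<7} C7 n i j"
    using walk_C7_forward[of i "j + 7 - i"] ij by auto
qed

lemma gdist_C7:
  assumes "i < j" "j < 7"
  shows "gdist {..<7} C7 i j = min (j - i) (7 - (j - i))"
  unfolding gdist_def
proof (rule Least_equality)
  have "i + 6 * (7 - (j - i)) = j + (6 - (j - i)) * 7" using assms by simp
  then have "(i + (j - i)) mod 7 = j" "(i + 6 * (7 - (j - i))) mod 7 = j"
    using assms by (simp_all only: mod_mult_self1) simp_all
  then show "walk {..<7} C7 (min (j - i) (7 - (j - i))) i j"
    using walk_C7_forward[of i "j - i"] walk_C7_backward[of i "7 - (j - i)"] assms
    by (auto simp: min_def)
next
  fix n assume "walk {..<7} C7 n i j"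
  then obtain z :: int where z: "\<bar>z\<bar> \<le> int n" "(int i + z) mod 7 = int j mod 7"
    using walk_C7_displacement by blast
  have "7 dvd (int i + z - int j)" using z(2) by (simp add: mod_eq_dvd_iff)
  then obtain k where k: "int i + z - int j = 7 * k" by (elim dvdE)
  \<comment> \<open>The displacement is z = (j - i) + 7 k. For k = 0 its modulus is j - i, for k <=
    -1 at least 7 - (j - i), and for k >= 1 more than 7.\<close>
  have "k \<le> -1 \<or> k = 0 \<or> k \<ge> 1" by arith
  then show "min (j - i) (7 - (j - i)) \<le> n"
    using assms z(1) k by (auto simp: min_def)
qed

section \<open>The Kamada--Kawai heptagon\<close>

text \<open>Squared Euclidean distances are of negative type: expanding the square, only the
  cross terms survive, and they form a square of a modulus in each coordinate.\<close>
lemma sq_dist_negative_type: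
  fixes u q :: "'a \<Rightarrow> complex"
  assumes u: "sum u I = 0"
  shows "(\<Sum>i\<in>I. \<Sum>j\<in>I. (cmod (q i - q j))\<^sup>2 * Re (u i * cnj (u j))) \<le> 0"
proof -
  define x where "x = (\<lambda>i. complex_of_real (Re (q i)))"
  define y where "y = (\<lambda>i. complex_of_real (Im (q i)))"
  define X where "X = (\<Sum>i\<in>I. x i * u i)"
  define Y where "Y = (\<Sum>i\<in>I. y i * u i)"
  define N where "N = (\<lambda>i. complex_of_real ((cmod (q i))\<^sup>2))"
  have prod: "(\<Sum>i\<in>I. \<Sum>j\<in>I. (f i * u i) * cnj (g j * u j)) = (\<Sum>i\<in>I. f i * u i) * cnj (\<Sum>j\<in>I. g j * u j)"
    for f g :: "'a \<Rightarrow> complex"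
    by (simp only: sum_product cnj_sum)
  have "of_real ((cmod (q i - q j))\<^sup>2) * (u i * cnj (u j))
      = (N i * u i) * cnj (1 * u j) + (1 * u i) * cnj (N j * u j)
        - 2 * ((x i * u i) * cnj (x j * u j)) - 2 * ((y i * u i) * cnj (y j * u j))" for i j
  proof -
    have d: "complex_of_real ((cmod (q i - q j))\<^sup>2) = N i + N j - 2 * (x i * x j) - 2 * (y i * y j)"
      unfolding N_def x_def y_def cmod_power2
      by (simp add: power2_eq_square algebra_simps)
    have "cnj (N j) = N j" "cnj (x j) = x j" "cnj (y j) = y j"
      unfolding N_def x_def y_def by simp_all
    then show ?thesis unfolding d by (simp add: algebra_simps)
  qed
  then have "(\<Sum>i\<in>I. \<Sum>j\<in>I. of_real ((cmod (q i - q j))\<^sup>2) * (u i * cnj (u j)))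
      = (\<Sum>i\<in>I. N i * u i) * cnj (\<Sum>j\<in>I. 1 * u j) + (\<Sum>i\<in>I. 1 * u i) * cnj (\<Sum>j\<in>I. N j * u j)
        - 2 * (X * cnj X) - 2 * (Y * cnj Y)"
    unfolding X_def Y_def
    by (simp only: sum.distrib sum_subtractf sum_distrib_left flip: prod)
  also have "\<dots> = of_real (- 2 * (cmod X)\<^sup>2 - 2 * (cmod Y)\<^sup>2)"
    using u by (simp flip: complex_norm_square)
  finally have "(\<Sum>i\<in>I. \<Sum>j\<in>I. of_real ((cmod (q i - q j))\<^sup>2) * (u i * cnj (u j)))
      = of_real (- 2 * (cmod X)\<^sup>2 - 2 * (cmod Y)\<^sup>2)" .
  then have "Re (\<Sum>i\<in>I. \<Sum>j\<in>I. of_real ((cmod (q i - q j))\<^sup>2) * (u i * cnj (u j)))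
      = - 2 * (cmod X)\<^sup>2 - 2 * (cmod Y)\<^sup>2"
    by (simp only: Re_complex_of_real)
  then show ?thesis by simp
qed

text \<open>Passes between the pairs i < j of the energy and the full double sum of the
  negative-type inequality.\<close>

lemma sum_pairs_half:
  fixes F :: "nat \<Rightarrow> nat \<Rightarrow> real"
  assumes sym: "\<And>i j. F i j = F j i" and diag: "\<And>i. F i i = 0" and "finite V"
  shows "(\<Sum>i\<in>V. \<Sum>j\<in>{j\<in>V. i < j}. F i j) = (\<Sum>i\<in>V. \<Sum>j\<in>V. F i j) / 2"
proof -
  have "(\<Sum>i\<in>V. \<Sum>j\<in>V. F i j)
      = (\<Sum>i\<in>V. \<Sum>j\<in>V. (if i < j then F i j else 0) + (if j < i then F i j else 0))"
    by (intro sum.cong refl) (auto simp: diag not_less_iff_gr_or_eq)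
  also have "\<dots> = (\<Sum>i\<in>V. \<Sum>j\<in>V. if i < j then F i j else 0) + (\<Sum>i\<in>V. \<Sum>j\<in>V. if j < i then F i j else 0)"
    by (simp only: sum.distrib)
  also have "(\<Sum>i\<in>V. \<Sum>j\<in>V. if j < i then F i j else 0) = (\<Sum>i\<in>V. \<Sum>j\<in>V. if i < j then F i j else 0)"
    by (subst sum.swap) (simp only: sym)
  finally show ?thesis
    using assms(3) by (simp add: sum.inter_filter)
qed

lemma sum_gdist_C7:
  fixes F :: "nat \<Rightarrow> real"
  shows "(\<Sum>i\<in>{..<7}. \<Sum>j\<in>{j\<in>{..<7}. i < j}. F (gdist {..<7} C7 i j)) = 7 * (F 1 + F 2 + F 3)"
proof -
  have "(\<Sum>i\<in>{..<7}. \<Sum>j\<in>{j\<in>{..<7}. i < j}. F (gdist {..<7} C7 i j))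
      = (\<Sum>i\<in>{..<7::nat}. \<Sum>j\<in>{..<7}. if i < j then F (min (j - i) (7 - (j - i))) else 0)"
    unfolding sum.inter_filter[OF finite_lessThan]
    by (intro sum.cong refl) (simp add: gdist_C7)
  also have "\<dots> = 7 * (F 1 + F 2 + F 3)"
    by (simp add: eval_nat_numeral)
  finally show ?thesis .
qed

text \<open>The diagonal spanning \<open>m\<close> sides of the heptagon inscribed in the unit
  circle.\<close>

definition chord :: "nat \<Rightarrow> real" where
  "chord m = cmod (1 - zeta ^ m)"

lemma zeta_power_diff: "i \<le> j \<Longrightarrow> zeta ^ i * cnj (zeta ^ j) = cnj (zeta ^ (j - i))"
proof -
  assume "i \<le> j"
  then have "zeta ^ j = zeta ^ i * zeta ^ (j - i)" by (simp flip: power_add del: cis_mult)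
  moreover have "zeta ^ i * cnj (zeta ^ i) = 1"
    by (simp only: zeta_power cis_cnj cis_mult) simp
  ultimately show ?thesis by (metis complex_cnj_mult mult.assoc mult_1)
qed

text \<open>Going round the other way conjugates the power of \<open>zeta\<close>, which changes
  neither modulus nor real part. Chord lengths and cosines thus depend on the graph distance
  alone.\<close>

lemma gdist_C7_cases:
  assumes "i < j" "j < 7"
  shows "gdist {..<7} C7 i j \<in> {1, 2, 3}"
    and "zeta ^ (j - i) = zeta ^ gdist {..<7} C7 i j \<or> zeta ^ (j - i) = cnj (zeta ^ gdist {..<7} C7 i j)"
proof -
  show "gdist {..<7} C7 i j \<in> {1, 2, 3}"
    unfolding gdist_C7[OF assms] using assms by (auto simp: min_def)
  have "zeta ^ (j - i) = cnj (zeta ^ (7 - (j - i)))"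
    using zeta_power_compl[of "j - i"] assms by simp
  then show "zeta ^ (j - i) = zeta ^ gdist {..<7} C7 i j \<or> zeta ^ (j - i) = cnj (zeta ^ gdist {..<7} C7 i j)"
    unfolding gdist_C7[OF assms] min_def by (simp only: split: if_split) blast
qed

lemma dist_gdist_C7:
  assumes "i < j" "j < 7"
  shows "cmod (zeta ^ i - zeta ^ j) = chord (gdist {..<7} C7 i j)"
proof -
  have "zeta ^ j = zeta ^ i * zeta ^ (j - i)"
    using assms by (simp flip: power_add del: cis_mult)
  then have "zeta ^ i - zeta ^ j = zeta ^ i * (1 - zeta ^ (j - i))"
    by (simp add: algebra_simps)
  then have "cmod (zeta ^ i - zeta ^ j) = cmod (1 - zeta ^ (j - i))"
    by (simp only: norm_mult cmod_zeta_power mult_1)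
  also have "\<dots> = chord (gdist {..<7} C7 i j)"
    using gdist_C7_cases(2)[OF assms]
  proof
    assume "zeta ^ (j - i) = cnj (zeta ^ gdist {..<7} C7 i j)"
    then have "1 - zeta ^ (j - i) = cnj (1 - zeta ^ gdist {..<7} C7 i j)" by simp
    then show ?thesis unfolding chord_def by (simp only: complex_mod_cnj)
  qed (simp add: chord_def)
  finally show ?thesis .
qed

lemma Re_zeta_gdist_C7:
  assumes "i < j" "j < 7"
  shows "Re ((zeta ^ k) ^ i * cnj ((zeta ^ k) ^ j)) = Re (zeta ^ (k * gdist {..<7} C7 i j))"
proof -
  have "(zeta ^ k) ^ i * cnj ((zeta ^ k) ^ j) = (zeta ^ i * cnj (zeta ^ j)) ^ k"
    by (simp only: power_mult_distrib complex_cnj_power mult.commute flip: power_mult)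
  also have "\<dots> = cnj (zeta ^ (j - i)) ^ k" using zeta_power_diff[of i j] assms by simp
  finally have eq: "(zeta ^ k) ^ i * cnj ((zeta ^ k) ^ j) = cnj (zeta ^ (j - i)) ^ k" .
  show ?thesis
    using gdist_C7_cases(2)[OF assms]
  proof
    assume "zeta ^ (j - i) = zeta ^ gdist {..<7} C7 i j"
    then have "cnj (zeta ^ (j - i)) ^ k = cnj (zeta ^ (k * gdist {..<7} C7 i j))"
      by (simp only: mult.commute flip: complex_cnj_power power_mult)
    then show ?thesis unfolding eq by (simp only: cnj.sel)
  next
    assume "zeta ^ (j - i) = cnj (zeta ^ gdist {..<7} C7 i j)"
    then show ?thesis
      unfolding eq by (simp only: mult.commute complex_cnj_cnj flip: power_mult)
  qed
qed

text \<open>The stress is minus a nonnegative combination of the cosines of frequencies 2 and 3. The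
  weights (zeta^k)^i sum to zero over the vertices, so the negative-type inequality applies to each
  frequency.\<close>

lemma stress_form_nonneg:
  assumes l: "l2 \<ge> 0" "l3 \<ge> 0"
    and om: "\<And>m. m \<in> {1,2,3} \<Longrightarrow> om m = - (l2 * Re (zeta ^ (2 * m)) + l3 * Re (zeta ^ (3 * m)))"
  shows "(\<Sum>i\<in>{..<7}. \<Sum>j\<in>{j\<in>{..<7}. i < j}. om (gdist {..<7} C7 i j) * (cmod (q i - q j))\<^sup>2) \<ge> 0"
proof -
  define G where "G = (\<lambda>k i j. (cmod (q i - q j))\<^sup>2 * Re ((zeta ^ k) ^ i * cnj ((zeta ^ k) ^ j)))"
  have G_sym: "G k i j = G k j i" for k i j
  proof -
    have "Re (a * cnj b) = Re (b * cnj a)" for a b by (simp add: mult.commute)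
    from this[of "(zeta ^ k) ^ i" "(zeta ^ k) ^ j"] show ?thesis
      unfolding G_def norm_minus_commute[of "q i"] by (simp only:)
  qed
  have G_neg: "(\<Sum>i\<in>{..<7}. \<Sum>j\<in>{j\<in>{..<7}. i < j}. G k i j) \<le> 0" if "0 < k" "k < 7" for k
  proof -
    have "(\<Sum>i\<in>{..<7}. \<Sum>j\<in>{j\<in>{..<7}. i < j}. G k i j) = (\<Sum>i\<in>{..<7}. \<Sum>j\<in>{..<7}. G k i j) / 2"
      by (rule sum_pairs_half[OF G_sym]) (simp_all add: G_def)
    also have "(\<Sum>i\<in>{..<7}. \<Sum>j\<in>{..<7}. G k i j) \<le> 0"
      unfolding G_def by (rule sq_dist_negative_type) (rule zeta_power_sum[OF that])
    finally show ?thesis by simp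
  qed
  have "(\<Sum>i\<in>{..<7}. \<Sum>j\<in>{j\<in>{..<7}. i < j}. om (gdist {..<7} C7 i j) * (cmod (q i - q j))\<^sup>2)
      = (\<Sum>i\<in>{..<7}. \<Sum>j\<in>{j\<in>{..<7}. i < j}. - l2 * G 2 i j - l3 * G 3 i j)"
  proof (intro sum.cong refl)
    fix i j :: nat assume "j \<in> {j \<in> {..<7}. i < j}"
    then have ij: "i < j" "j < 7" by auto
    show "om (gdist {..<7} C7 i j) * (cmod (q i - q j))\<^sup>2 = - l2 * G 2 i j - l3 * G 3 i j"
      unfolding om[OF gdist_C7_cases(1)[OF ij]] G_def Re_zeta_gdist_C7[OF ij]
      by (simp add: algebra_simps)
  qed
  also have "\<dots> = - l2 * (\<Sum>i\<in>{..<7}. \<Sum>j\<in>{j\<in>{..<7}. i < j}. G 2 i j)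
      - l3 * (\<Sum>i\<in>{..<7}. \<Sum>j\<in>{j\<in>{..<7}. i < j}. G 3 i j)"
    by (simp only: sum_subtractf sum_distrib_left)
  also have "\<dots> \<ge> 0"
    using mult_nonneg_nonpos[OF l(1) G_neg[of 2]] mult_nonneg_nonpos[OF l(2) G_neg[of 3]] by simp
  finally show ?thesis .
qed

text \<open>Up to a positive factor, $l_k$ is the eigenvalue of the stress at frequency $k$, and the
  formula for \<open>om m\<close> is Fourier inversion. The last equation expresses that $R$ is the
  critical scale; it is what makes the eigenvalue at frequency 1 vanish.\<close>
lemma heptagon_stress:
  obtains R l2 l3 om where "R > 0" "l2 \<ge> 0" "l3 \<ge> 0"
    and "\<forall>m\<in>{1,2,3}. chord m > 0 \<and> om m = (1 - real m / (R * chord m)) / (real m)\<^sup>2"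
    and "\<forall>m\<in>{1,2,3}. om m = - (l2 * Re (zeta ^ (2 * m)) + l3 * Re (zeta ^ (3 * m)))"
    and "om 1 * (R * chord 1)\<^sup>2 + om 2 * (R * chord 2)\<^sup>2 + om 3 * (R * chord 3)\<^sup>2 = 0"
proof -
  define C where "C = Re zeta"
  define C2 where "C2 = Re (zeta ^ 2)"
  define C3 where "C3 = Re (zeta ^ 3)"
  have zz: "zeta * cnj zeta = 1" by (simp add: cis_cnj cis_mult)
  have two: "complex_of_real (2 * C) = zeta + 1 / zeta"
  proof -
    have "1 / zeta = cnj zeta" using zz zeta_nz by (simp add: field_simps)
    then show ?thesis unfolding C_def by (simp only: complex_add_cnj)
  qed
  have "complex_of_real ((2 * C) ^ 3 + (2 * C) ^ 2 - 2 * (2 * C) - 1) = 0"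
    using zeta_cubic unfolding cubic_def two[symmetric] by simp
  then have "(2 * C) ^ 3 + (2 * C) ^ 2 - 2 * (2 * C) - 1 = 0"
    by (simp only: of_real_eq_0_iff)
  then have cub: "8 * C ^ 3 = 1 + 4 * C - 4 * C ^ 2"
    by (simp add: power_mult_distrib)
  have ReIm: "(Im zeta)\<^sup>2 = 1 - C\<^sup>2"
    unfolding C_def by (simp add: sin_squared_eq)
  have C2: "C2 = 2 * C\<^sup>2 - 1"
    using ReIm unfolding C2_def C_def by (simp add: power2_eq_square)
  have C3': "C3 = 4 * C ^ 3 - 3 * C"
  proof -
    have "C3 = C * C\<^sup>2 - 3 * C * (Im zeta)\<^sup>2"
      unfolding C3_def C_def by (simp add: power2_eq_square power3_eq_cube algebra_simps del: cis.sel)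
    then show ?thesis unfolding ReIm by (simp add: algebra_simps power2_eq_square power3_eq_cube)
  qed
  have C3: "C3 = 1 / 2 - C - 2 * C\<^sup>2"
    using C3' cub by simp
  \<comment> \<open>Separates cos(2 pi / 7) from the other two roots of its cubic, which are
    negative.\<close>
  have C_half: "C > 1 / 2"
  proof -
    have "cos (pi / 3) < cos (2 * pi / 7)"
      by (rule cos_monotone_0_pi) (use pi_gt_zero in auto)
    then show ?thesis unfolding C_def by (simp add: cos_60)
  qed
  have Re4: "Re (zeta ^ 4) = C3" and Re6: "Re (zeta ^ 6) = C" and Re9: "Re (zeta ^ 9) = C2"
  proof -
    have "zeta ^ 4 = cnj (zeta ^ 3)" "zeta ^ 6 = cnj zeta" "zeta ^ 9 = zeta ^ 2"
      using zeta_power_compl[of 3] zeta_power_compl[of 1] zeta_power_mod[of 9] by simp_all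
    then show "Re (zeta ^ 4) = C3" "Re (zeta ^ 6) = C" "Re (zeta ^ 9) = C2"
      unfolding C_def C2_def C3_def by (simp_all only: cnj.sel)
  qed
  have C_bounds: "623 / 1000 < C" "C < 624 / 1000"
  proof -
    \<comment> \<open>As C is a root, the cubic at a is (a - C) times its divided difference. That
      factor is positive for a > 1/2, so the sign of the cubic at a rational a locates C.\<close>
    have factor: "8 * a ^ 3 + 4 * a\<^sup>2 - 4 * a - 1 = (a - C) * (8 * C\<^sup>2 + (4 + 8 * a) * C + (a * (4 + 8 * a) - 4))" for a
      using cub by (simp add: algebra_simps power2_eq_square power3_eq_cube)
    have pos: "8 * C\<^sup>2 + (4 + 8 * a) * C + (a * (4 + 8 * a) - 4) > 0" if "a > 1 / 2" for a
    proof -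
      have "C\<^sup>2 > (1 / 2)\<^sup>2" using C_half by (intro power_strict_mono) auto
      moreover have "(4 + 8 * a) * C > 8 * (1 / 2)" "a * (4 + 8 * a) > 1 / 2 * 8"
        using that C_half by (intro mult_strict_mono; simp)+
      ultimately show ?thesis by (simp add: power2_eq_square)
    qed
    have "(623 / 1000 - C) * (8 * C\<^sup>2 + (4 + 8 * (623 / 1000)) * C + (623 / 1000 * (4 + 8 * (623 / 1000)) - 4)) < 0"
      unfolding factor[symmetric] by (simp add: power2_eq_square power3_eq_cube)
    then show "623 / 1000 < C" using pos[of "623 / 1000"] by (simp add: mult_less_0_iff)
    have "(624 / 1000 - C) * (8 * C\<^sup>2 + (4 + 8 * (624 / 1000)) * C + (624 / 1000 * (4 + 8 * (624 / 1000)) - 4)) > 0"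
      unfolding factor[symmetric] by (simp add: power2_eq_square power3_eq_cube)
    then show "C < 624 / 1000" using pos[of "624 / 1000"] by (simp add: zero_less_mult_iff)
  qed
  have Csq: "388 / 1000 < C\<^sup>2" "C\<^sup>2 < 3895 / 10000"
    using mult_strict_mono[OF C_bounds(1) C_bounds(1)] mult_strict_mono[OF C_bounds(2) C_bounds(2)] C_half
    by (simp_all add: power2_eq_square)
  have chord_sq: "(chord m)\<^sup>2 = 2 - 2 * Re (zeta ^ m)" for m
  proof -
    have "(Re (zeta ^ m))\<^sup>2 + (Im (zeta ^ m))\<^sup>2 = 1"
      using cmod_zeta_power[of m] by (simp only: cmod_power2[symmetric]) simp
    then show ?thesis
      unfolding chord_def cmod_power2 by (simp add: power2_eq_square algebra_simps)
  qed
  have c1: "(chord 1)\<^sup>2 = 2 - 2 * C" and c2: "(chord 2)\<^sup>2 = 2 - 2 * C2" and c3: "(chord 3)\<^sup>2 = 2 - 2 * C3"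
    unfolding chord_sq C_def C2_def C3_def by simp_all
  have b1: "chord 1 \<ge> 867 / 1000" and b2: "chord 2 \<ge> 156 / 100" and b3: "chord 3 \<ge> 194 / 100"
  proof -
    show "chord 1 \<ge> 867 / 1000"
      by (rule power2_le_imp_le) (use c1 C_bounds in \<open>simp_all add: power2_eq_square chord_def\<close>)
    show "chord 2 \<ge> 156 / 100"
      by (rule power2_le_imp_le) (use c2 C2 Csq in \<open>simp_all add: power2_eq_square chord_def\<close>)
    show "chord 3 \<ge> 194 / 100"
      by (rule power2_le_imp_le) (use c3 C3 C_bounds Csq in \<open>simp_all add: power2_eq_square chord_def\<close>)
  qed
  \<comment> \<open>The energy of the heptagon of radius R is 7/2 times the sum of (R * chord m / m
    - 1)^2 over m = 1, 2, 3. Its derivative in R vanishes at R = D / W.\<close>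
  define W where "W = (chord 1)\<^sup>2 + (chord 2)\<^sup>2 / 4 + (chord 3)\<^sup>2 / 9"
  define D where "D = chord 1 + chord 2 / 2 + chord 3 / 3"
  define R where "R = D / W"
  have W_eq: "W = 28 / 9 - 16 / 9 * C - 5 / 9 * C\<^sup>2"
    unfolding W_def c1 c2 c3 C2 C3 by (simp add: field_simps)
  have W: "0 < W" "W \<le> 179 / 100"
    unfolding W_eq using C_bounds Csq by simp_all
  have D: "D \<ge> 229 / 100" unfolding D_def using b1 b2 b3 by simp
  have R: "R \<ge> 127 / 100"
  proof -
    have "127 / 100 * W \<le> D" using W D by simp
    then show ?thesis unfolding R_def using W by (simp add: field_simps)
  qed
  define om where "om = (\<lambda>m. (1 - real m / (R * chord m)) / (real m)\<^sup>2)"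
  have Rc: "R * chord 1 \<ge> 11 / 10" "R * chord 2 \<ge> 195 / 100" "R * chord 3 \<ge> 24 / 10"
    using mult_mono[OF R b1] mult_mono[OF R b2] mult_mono[OF R b3] R b1 b2 b3 by simp_all
  have om1: "om 1 \<ge> 9 / 100" and om2: "om 2 \<ge> - (1 / 100)" and om3: "om 3 \<ge> - (3 / 100)"
    unfolding om_def using Rc by (simp_all add: field_simps)
  have balance: "om 1 * (R * chord 1)\<^sup>2 + om 2 * (R * chord 2)\<^sup>2 + om 3 * (R * chord 3)\<^sup>2 = 0"
  proof -
    have t: "om m * (R * chord m)\<^sup>2 = R * (R * (chord m)\<^sup>2 / (real m)\<^sup>2 - chord m / real m)"
      if "chord m > 0" "m > 0" for m
      unfolding om_def using that R by (simp add: field_simps power2_eq_square)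
    have "om 1 * (R * chord 1)\<^sup>2 + om 2 * (R * chord 2)\<^sup>2 + om 3 * (R * chord 3)\<^sup>2 = R * (R * W - D)"
      using t[of 1] t[of 2] t[of 3] b1 b2 b3 unfolding W_def D_def by (simp add: algebra_simps)
    then show ?thesis unfolding R_def using W by simp
  qed
  \<comment> \<open>Since chord m squared is 2 (1 - cos(2 pi m / 7)), the balance equation is 2 R^2
    times this one.\<close>
  have eigen1: "om 1 * (1 - C) + om 2 * (1 - C2) + om 3 * (1 - C3) = 0"
  proof -
    have "2 * R\<^sup>2 * (om 1 * (1 - C) + om 2 * (1 - C2) + om 3 * (1 - C3)) = 0"
      using balance unfolding power_mult_distrib c1 c2 c3 by (simp add: algebra_simps)
    then show ?thesis using R by simp
  qed
  \<comment> \<open>At frequency k the stress \<open>om m\<close> is weighted by 1 - cos(2 pi k m /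
    7). The factor 4/7 normalises the inversion below, where \<open>k1\<close> is -7/4.\<close>
  define l2 where "l2 = 4 / 7 * (om 1 * (1 - C2) + om 2 * (1 - C3) + om 3 * (1 - C))"
  define l3 where "l3 = 4 / 7 * (om 1 * (1 - C3) + om 2 * (1 - C) + om 3 * (1 - C2))"
  have coeff: "12 / 10 \<le> 1 - C2" "1 - C2 \<le> 125 / 100" "189 / 100 \<le> 1 - C3" "1 - C3 \<le> 2" "37 / 100 \<le> 1 - C" "1 - C \<le> 38 / 100"
    unfolding C2 C3 using C_bounds Csq by simp_all
  have low: "om 1 * x \<ge> 9 / 100 * x" "om 2 * x \<ge> - (1 / 100) * x" "om 3 * x \<ge> - (3 / 100) * x" if "x \<ge> 0" for x
    using mult_right_mono[OF om1 that] mult_right_mono[OF om2 that] mult_right_mono[OF om3 that] by simp_all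
  \<comment> \<open>The positive \<open>om 1\<close> outweighs the possibly negative
    \<open>om 2\<close> and \<open>om 3\<close>: 0.108 against at most 0.02 + 0.0375.\<close>
  have combine: "0 \<le> 4 / 7 * (om 1 * x + om 2 * y + om 3 * z)"
    if "12 / 10 \<le> x" "0 \<le> y" "y \<le> 2" "0 \<le> z" "z \<le> 125 / 100" for x y z
  proof -
    have x: "0 \<le> x" using that by simp
    have "0 \<le> 9 / 100 * x - 1 / 100 * y - 3 / 100 * z" using that by simp
    also have "\<dots> \<le> om 1 * x + om 2 * y + om 3 * z"
      using low(1)[OF x] low(2)[OF that(2)] low(3)[OF that(4)] by linarith
    finally show ?thesis by simp
  qed
  have l2: "l2 \<ge> 0" and l3: "l3 \<ge> 0"
    unfolding l2_def l3_def by (rule combine; use coeff in linarith)+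
  \<comment> \<open>The product-to-sum formulas for the three cosines, obtained here by reducing
    powers of C with its cubic.\<close>
  have prods: "C * C = (1 + C2) / 2" "C2 * C2 = (1 + C3) / 2" "C3 * C3 = (1 + C) / 2"
    "C * C2 = (C + C3) / 2" "C * C3 = (C2 + C3) / 2" "C2 * C3 = (C + C2) / 2" "C3 = - 1 / 2 - C - C2"
  proof -
    have cub': "C ^ 3 = (1 + 4 * C - 4 * C ^ 2) / 8" using cub by simp
    have quart: "C ^ 4 = (C + 4 * C ^ 2 - 4 * C ^ 3) / 8"
      using arg_cong[OF cub', of "\<lambda>x. C * x"] by (simp add: algebra_simps eval_nat_numeral)
    show "C * C = (1 + C2) / 2" unfolding C2 by (simp add: power2_eq_square)
    show "C2 * C2 = (1 + C3) / 2"  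
      unfolding C2 C3 using quart cub' by (simp add: algebra_simps eval_nat_numeral)
    show "C3 * C3 = (1 + C) / 2" 
      unfolding C3 using quart cub' by (simp add: algebra_simps eval_nat_numeral)
    show "C * C2 = (C + C3) / 2" 
      unfolding C2 C3 using quart cub' by (simp add: algebra_simps eval_nat_numeral)
    show "C * C3 = (C2 + C3) / 2" 
      unfolding C2 C3 using quart cub' by (simp add: algebra_simps eval_nat_numeral)
    show "C2 * C3 = (C + C2) / 2" 
      unfolding C2 C3 using quart cub' by (simp add: algebra_simps eval_nat_numeral)
    show "C3 = - 1 / 2 - C - C2" unfolding C2 C3 by simp
  qed
  \<comment> \<open>Products of the eigenvalue coefficients with the cosines. Their values -7/4, 0,
    0 are the orthogonality relations behind the Fourier inversion.\<close>
  define k1 where "k1 = (1 - C) * C + (1 - C2) * C2 + (1 - C3) * C3"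
  define k2 where "k2 = (1 - C2) * C + (1 - C3) * C2 + (1 - C) * C3"
  define k3 where "k3 = (1 - C3) * C + (1 - C) * C2 + (1 - C2) * C3"
  have k: "k1 = - 7 / 4" "k2 = 0" "k3 = 0"
  proof -
    have "k1 = C + C2 + C3 - (C * C + C2 * C2 + C3 * C3)"
      "k2 = C + C2 + C3 - (C * C2 + C2 * C3 + C * C3)"
      "k3 = C + C2 + C3 - (C * C3 + C * C2 + C2 * C3)"
      unfolding k1_def k2_def k3_def by (simp_all add: algebra_simps)
    then show "k1 = - 7 / 4" "k2 = 0" "k3 = 0"
      unfolding prods(1-6) using prods(7) by (simp_all add: field_simps)
  qed
  define l1 where "l1 = 4 / 7 * (om 1 * (1 - C) + om 2 * (1 - C2) + om 3 * (1 - C3))"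
  have "l1 * C + l2 * C2 + l3 * C3 = 4 / 7 * (om 1 * k1 + om 2 * k2 + om 3 * k3)"
    "l1 * C2 + l2 * C3 + l3 * C = 4 / 7 * (om 1 * k3 + om 2 * k1 + om 3 * k2)"
    "l1 * C3 + l2 * C + l3 * C2 = 4 / 7 * (om 1 * k2 + om 2 * k3 + om 3 * k1)"
    unfolding l1_def l2_def l3_def k1_def k2_def k3_def by algebra+
  moreover have "l1 = 0" unfolding l1_def using eigen1 by simp
  ultimately have inv: "om 1 = - (l2 * C2 + l3 * C3)" "om 2 = - (l2 * C3 + l3 * C)" "om 3 = - (l2 * C + l3 * C2)"
    by (simp_all add: k)
  show thesis
  proof (rule that)
    show "R > 0" using R by simp
    show "l2 \<ge> 0" "l3 \<ge> 0" using l2 l3 by auto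
    show "\<forall>m\<in>{1,2,3}. chord m > 0 \<and> om m = (1 - real m / (R * chord m)) / (real m)\<^sup>2"
      using b1 b2 b3 unfolding om_def by auto
    show "\<forall>m\<in>{1,2,3}. om m = - (l2 * Re (zeta ^ (2 * m)) + l3 * Re (zeta ^ (3 * m)))"
      using inv Re4 Re6 Re9 unfolding C_def C2_def C3_def by auto
    show "om 1 * (R * chord 1)\<^sup>2 + om 2 * (R * chord 2)\<^sup>2 + om 3 * (R * chord 3)\<^sup>2 = 0"
      by (rule balance)
  qed
qed

lemma KK_heptagon: "\<exists>R>0. KK_equilibrium {..<7} C7 (\<lambda>v. of_real R * zeta ^ v)"
proof -
  obtain R l2 l3 om where R: "R > 0" and l: "l2 \<ge> 0" "l3 \<ge> 0"
    and om: "\<forall>m\<in>{1,2,3}. chord m > 0 \<and> om m = (1 - real m / (R * chord m)) / (real m)\<^sup>2"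
    and om_spec: "\<forall>m\<in>{1,2,3}. om m = - (l2 * Re (zeta ^ (2 * m)) + l3 * Re (zeta ^ (3 * m)))"
    and balance: "om 1 * (R * chord 1)\<^sup>2 + om 2 * (R * chord 2)\<^sup>2 + om 3 * (R * chord 3)\<^sup>2 = 0"
    by (rule heptagon_stress)
  define p where "p = (\<lambda>v. complex_of_real R * zeta ^ v)"
  define g where "g = gdist {..<7} C7"
  have "KK_energy {..<7} C7 p \<le> KK_energy {..<7} C7 q" for q
  proof -
    have pair_bound: "1/2 * (1 / (real (g i j))^2) * (cmod (q i - q j) - real (g i j))^2
        - 1/2 * (1 / (real (g i j))^2) * (cmod (p i - p j) - real (g i j))^2
        \<ge> 1/2 * (om (g i j) * (cmod (q i - q j))\<^sup>2 - om (g i j) * (R * chord (g i j))\<^sup>2)"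
      if ij: "i < j" "j < 7" for i j
    proof -
      define m where "m = real (g i j)"
      define r where "r = R * chord (g i j)"
      define x where "x = cmod (q i - q j)"
      have g: "g i j \<in> {1,2,3}" unfolding g_def by (rule gdist_C7_cases(1)[OF ij])
      have m: "m > 0" unfolding m_def using g by auto
      define t where "t = 1 - m / r"
      define k where "k = 1 / m\<^sup>2"
      have r: "r > 0" and o: "om (g i j) = k * t"
        using bspec[OF om g] R unfolding r_def m_def t_def k_def by simp_all
      have "p i - p j = of_real R * (zeta ^ i - zeta ^ j)"
        unfolding p_def by (simp add: algebra_simps)
      then have pr: "cmod (p i - p j) = r"
        using dist_gdist_C7[OF ij] R unfolding r_def g_def by (simp only: norm_mult) simp
      \<comment> \<open>The slope t makes the bound linear in x^2 touch the spring energy at x = r;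
        the gap is a nonnegative multiple of a square.\<close>
      have "(x - m)\<^sup>2 - (r - m)\<^sup>2 - t * (x\<^sup>2 - r\<^sup>2) = m / r * (x - r)\<^sup>2"
        using r unfolding t_def by (simp add: field_simps power2_eq_square)
      moreover have "m / r * (x - r)\<^sup>2 \<ge> 0" using m r by simp
      ultimately have "t * (x\<^sup>2 - r\<^sup>2) \<le> (x - m)\<^sup>2 - (r - m)\<^sup>2" by linarith
      then have "k * (t * (x\<^sup>2 - r\<^sup>2)) \<le> k * ((x - m)\<^sup>2 - (r - m)\<^sup>2)"
        by (rule mult_left_mono) (simp add: k_def)
      then have "1/2 * (k * t * x\<^sup>2 - k * t * r\<^sup>2) \<le> 1/2 * k * (x - m)\<^sup>2 - 1/2 * k * (r - m)\<^sup>2"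
        by (simp add: right_diff_distrib mult.assoc)
      then show ?thesis
        unfolding o pr m_def[symmetric] x_def[symmetric] r_def[symmetric] k_def[symmetric] .
    qed
    have "KK_energy {..<7} C7 q - KK_energy {..<7} C7 p
        \<ge> (\<Sum>i\<in>{..<7}. \<Sum>j\<in>{j\<in>{..<7}. i < j}.
             1/2 * (om (g i j) * (cmod (q i - q j))\<^sup>2 - om (g i j) * (R * chord (g i j))\<^sup>2))"
      unfolding KK_energy_def g_def[symmetric] sum_subtractf[symmetric]
      by (intro sum_mono pair_bound) auto
    moreover have "(\<Sum>i\<in>{..<7}. \<Sum>j\<in>{j\<in>{..<7}. i < j}.
             1/2 * (om (g i j) * (cmod (q i - q j))\<^sup>2 - om (g i j) * (R * chord (g i j))\<^sup>2))
        = 1/2 * ((\<Sum>i\<in>{..<7}. \<Sum>j\<in>{j\<in>{..<7}. i < j}. om (g i j) * (cmod (q i - q j))\<^sup>2)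
            - (\<Sum>i\<in>{..<7}. \<Sum>j\<in>{j\<in>{..<7}. i < j}. om (g i j) * (R * chord (g i j))\<^sup>2))"
      by (simp only: sum_subtractf flip: sum_distrib_left)
    \<comment> \<open>Each distance occurs for seven pairs, so at the heptagon the stress form is 7
      times the balance equation.\<close>
    moreover have "(\<Sum>i\<in>{..<7}. \<Sum>j\<in>{j\<in>{..<7}. i < j}. om (g i j) * (R * chord (g i j))\<^sup>2) = 0"
      unfolding g_def using sum_gdist_C7[of "\<lambda>m. om m * (R * chord m)\<^sup>2"] balance by simp
    moreover have "(\<Sum>i\<in>{..<7}. \<Sum>j\<in>{j\<in>{..<7}. i < j}. om (g i j) * (cmod (q i - q j))\<^sup>2) \<ge> 0"
      unfolding g_def by (rule stress_form_nonneg[OF l bspec[OF om_spec]])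
    ultimately show ?thesis by simp
  qed
  then have "KK_equilibrium {..<7} C7 p"
    \<comment> \<open>The minimum is global, so any radius serves; 1 is taken.\<close>
    unfolding KK_equilibrium_def using connected_C7 by (auto intro: exI[of _ 1])
  then show ?thesis using R unfolding p_def by blast
qed

theorem theorem1:
  shows "\<exists>E. simple_graph {..<7::nat} E \<and>
    (\<exists>p. FR_equilibrium {..<7} E p \<and>
         (\<forall>T q. congruent_drawing {..<7} p q \<longrightarrow> \<not> qtree_computes T {..<7} q)) \<and>
    (\<exists>p. KK_equilibrium {..<7} E p \<and>
         (\<forall>T q. congruent_drawing {..<7} p q \<longrightarrow> \<not> qtree_computes T {..<7} q))"
proof -
  let ?s = "root 3 3 / cmod (zeta - 1)"
  obtain R where R: "R > 0" "KK_equilibrium {..<7} C7 (\<lambda>v. of_real R * zeta ^ v)"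
    using KK_heptagon by blast
  have "\<not> qtree_computes T {..<7} q" if "s > 0" "congruent_drawing {..<7} (\<lambda>v. of_real s * zeta ^ v) q" for s T q
    using heptagon_not_computable[of s q T] that by simp
  then show ?thesis using simple_graph_C7 FR_heptagon R by blast
qed

end
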